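(* Let $G$ be a Hausdorff topological group. (1) If $\mathcal{S}$ is a non-trivial generalized central factorization of $G$, then the diagonal map $$d: G \to \prod_{N\in \mathcal{S}}G/G_{\mathcal{S}\setminus\{N\}},\qquad g\mapsto (gG_{\mathcal{S}\setminus\{N\}})_{N\in\mathcal{S}},$$ is a continuous homomorphism such that $d(G) \cap G/G_{\mathcal{S}\setminus \{N\}}$ is dense in $G/G_{\mathcal{S}\setminus \{N\}}$ for every $N\in \mathcal{S}$, and $\ker(d)$ is central in $G$. Furthermore, $\mathcal{S}$ is a quasi-direct factorization of $G$ if and only if $d$ is injective. (2) Let $\mathcal{K}$ be a set of Hausdorff topological groups and suppose that $G$ admits an injective, continuous homomorphism $\delta: G \to \prod_{K\in \mathcal{K}}K$ such that $\delta(G) \cap K$ is dense in $K$ for each $K\in \mathcal{K}$. For $\mathcal{S} := \{\delta^{-1}(K) \mid K\in \mathcal{K}\}$, the closed subgroup $\overline{\langle \mathcal{S}\rangle}$ of $G$ topologically generated by $\bigcup\mathcal S$ is a quasi-product of $\mathcal{S}$.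
   Context: For a topological group $G$, let $\mathcal{N}(G)$ be the set of closed normal subgroups of $G$, and for $J\subseteq\mathcal{N}(G)$ let $G_J := \overline{\langle N\mid N\in J\rangle}$ (so $G_\emptyset=\{1\}$). A set $\mathcal{S}\subseteq\mathcal{N}(G)$ is a generalized central factorization of $G$ if $\{1\}\notin\mathcal{S}$, $G_{\mathcal{S}}=G$, and $[N,M]=\{1\}$ for any $N\neq M$ in $\mathcal{S}$. A set $\mathcal{S}\subseteq\mathcal{N}(G)$ is a quasi-direct factorization of $G$ (and $G$ is then said to be a quasi-product of $\mathcal S$) if $\{1\}\notin\mathcal{S}$, $G_{\mathcal{S}}=G$, and for every set $X$ of subsets of $\mathcal{S}$ with $\bigcap X=\emptyset$ one has $\bigcap_{A\in X}G_A=\{1\}$ (with the convention that the empty intersection of subsets of $\mathcal S$ is $\mathcal{S}$, and the empty intersection of subgroups of $G$ is $G$). A factorization $\mathcal{S}$ is non-trivial if $|\mathcal{S}|\geq 2$. Products of topological groups carry the product topology, and each factor of a direct product is identified with the subgroup of elements supported on the corresponding coordinate.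
   Formalization: In (2) every K in the set 𝒦 is additionally assumed to be a non-trivial group; if some K is trivial then δ^{-1}(K)={1} lies in 𝒮, which the definition of a quasi-direct factorization forbids, so the claim fails. *)

theory Defs
  imports
    "HOL-Algebra.Product_Groups"
    "HOL-Analysis.Function_Topology"
    "HOL-Analysis.T1_Spaces"
begin

locale topological_group = group G for G :: "('a, 'm) monoid_scheme" (structure) +
  fixes T :: "'a topology"
  assumes topspace_eq_carrier: "topspace T = carrier G"
    and continuous_mult: "continuous_map (prod_topology T T) T (\<lambda>(x, y). x \<otimes> y)"
    and continuous_inv: "continuous_map T T (\<lambda>x. inv x)"

definition closed_normal_subgroups :: "('a, 'm) monoid_scheme \<Rightarrow> 'a topology \<Rightarrow> 'a set set"
  where "closed_normal_subgroups G T = {N. N \<lhd> G \<and> closedin T N}"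

definition top_generated :: "('a, 'm) monoid_scheme \<Rightarrow> 'a topology \<Rightarrow> 'a set set \<Rightarrow> 'a set"
  where "top_generated G T J = T closure_of (generate G (\<Union>J))"

definition commutator_subgroup :: "('a, 'm) monoid_scheme \<Rightarrow> 'a set \<Rightarrow> 'a set \<Rightarrow> 'a set"
  where "commutator_subgroup G N M =
    generate G (\<Union>x\<in>N. \<Union>y\<in>M. {x \<otimes>\<^bsub>G\<^esub> y \<otimes>\<^bsub>G\<^esub> inv\<^bsub>G\<^esub> x \<otimes>\<^bsub>G\<^esub> inv\<^bsub>G\<^esub> y})"

definition group_center :: "('a, 'm) monoid_scheme \<Rightarrow> 'a set"
  where "group_center G = {z \<in> carrier G. \<forall>g\<in>carrier G. z \<otimes>\<^bsub>G\<^esub> g = g \<otimes>\<^bsub>G\<^esub> z}"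

definition generalized_central_factorization ::
    "('a, 'm) monoid_scheme \<Rightarrow> 'a topology \<Rightarrow> 'a set set \<Rightarrow> bool"
  where "generalized_central_factorization G T S \<longleftrightarrow>
    S \<subseteq> closed_normal_subgroups G T \<and>
    {\<one>\<^bsub>G\<^esub>} \<notin> S \<and>
    top_generated G T S = carrier G \<and>
    (\<forall>N\<in>S. \<forall>M\<in>S. N \<noteq> M \<longrightarrow> commutator_subgroup G N M = {\<one>\<^bsub>G\<^esub>})"

text \<open>
  Intersecting with \<open>S\<close>, respectively with \<open>carrier G\<close>, implements the convention that the empty
  intersection of subsets of \<open>S\<close> is \<open>S\<close> and the empty intersection of subgroups of \<open>G\<close> is \<open>G\<close>;
  for nonempty \<open>X\<close> it changes nothing.
\<close>

definition quasi_direct_factorization ::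
    "('a, 'm) monoid_scheme \<Rightarrow> 'a topology \<Rightarrow> 'a set set \<Rightarrow> bool"
  where "quasi_direct_factorization G T S \<longleftrightarrow>
    S \<subseteq> closed_normal_subgroups G T \<and>
    {\<one>\<^bsub>G\<^esub>} \<notin> S \<and>
    top_generated G T S = carrier G \<and>
    (\<forall>X. X \<subseteq> Pow S \<and> S \<inter> \<Inter>X = {} \<longrightarrow>
         carrier G \<inter> (\<Inter>A\<in>X. top_generated G T A) = {\<one>\<^bsub>G\<^esub>})"

text \<open>
  This is \<open>card S \<ge> 2\<close>, but also true of infinite \<open>S\<close>, for which \<open>card S = 0\<close>.
\<close>

definition nontrivial_factorization :: "'a set set \<Rightarrow> bool"
  where "nontrivial_factorization S \<longleftrightarrow> (\<exists>N\<in>S. \<exists>M\<in>S. N \<noteq> M)"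

definition quotient_group_topology ::
    "('a, 'm) monoid_scheme \<Rightarrow> 'a topology \<Rightarrow> 'a set \<Rightarrow> 'a set topology"
  where "quotient_group_topology G T N =
    topology (\<lambda>U. U \<subseteq> carrier (G Mod N) \<and> openin T {x \<in> topspace T. N #>\<^bsub>G\<^esub> x \<in> U})"

lemma openin_quotient_group_topology:
  "openin (quotient_group_topology G T N) U \<longleftrightarrow>
     U \<subseteq> carrier (G Mod N) \<and> openin T {x \<in> topspace T. N #>\<^bsub>G\<^esub> x \<in> U}"
proof -
  let ?P = "\<lambda>x U. N #>\<^bsub>G\<^esub> x \<in> U"
  have "istopology (\<lambda>U. U \<subseteq> carrier (G Mod N) \<and> openin T {x \<in> topspace T. ?P x U})"
    unfolding istopology_def
  proof (intro conjI allI impI)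
    fix U V
    assume U: "U \<subseteq> carrier (G Mod N) \<and> openin T {x \<in> topspace T. ?P x U}"
      and V: "V \<subseteq> carrier (G Mod N) \<and> openin T {x \<in> topspace T. ?P x V}"
    show "U \<inter> V \<subseteq> carrier (G Mod N)"
      using U by blast
    have "{x \<in> topspace T. ?P x (U \<inter> V)} = {x \<in> topspace T. ?P x U} \<inter> {x \<in> topspace T. ?P x V}"
      by blast
    then show "openin T {x \<in> topspace T. ?P x (U \<inter> V)}"
      using U V by (simp add: openin_Int)
  next
    fix \<U>
    assume U: "\<forall>U\<in>\<U>. U \<subseteq> carrier (G Mod N) \<and> openin T {x \<in> topspace T. ?P x U}"
    then show "\<Union>\<U> \<subseteq> carrier (G Mod N)"
      by blast
    have "{x \<in> topspace T. ?P x (\<Union>\<U>)} = \<Union>((\<lambda>U. {x \<in> topspace T. ?P x U}) ` \<U>)"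
      by blast
    then show "openin T {x \<in> topspace T. ?P x (\<Union>\<U>)}"
      using U by auto
  qed
  then show ?thesis
    by (simp add: quotient_group_topology_def)
qed

lemma (in topological_group) topspace_quotient_group_topology:
  "topspace (quotient_group_topology G T N) = carrier (G Mod N)"
proof
  show "topspace (quotient_group_topology G T N) \<subseteq> carrier (G Mod N)"
    using openin_quotient_group_topology openin_topspace by metis
  have "{x \<in> topspace T. N #> x \<in> carrier (G Mod N)} = topspace T"
    by (auto simp: topspace_eq_carrier carrier_FactGroup)
  then have "openin (quotient_group_topology G T N) (carrier (G Mod N))"
    by (simp add: openin_quotient_group_topology)
  then show "carrier (G Mod N) \<subseteq> topspace (quotient_group_topology G T N)"
    by (rule openin_subset)
qed

lemma (in topological_group) quotient_map_quotient_group_topology: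
  "quotient_map T (quotient_group_topology G T N) (\<lambda>x. N #> x)"
  by (auto simp: quotient_map_def topspace_quotient_group_topology openin_quotient_group_topology
      topspace_eq_carrier carrier_FactGroup)

text \<open>
  The factor with index \<open>i\<close> of a direct product, as the subgroup of the elements supported
  on the coordinate \<open>i\<close>.
\<close>

definition product_factor :: "'i set \<Rightarrow> ('i \<Rightarrow> ('b, 'm) monoid_scheme) \<Rightarrow> 'i \<Rightarrow> ('i \<Rightarrow> 'b) set"
  where "product_factor I H i =
    {f \<in> carrier (product_group I H). \<forall>j\<in>I. j \<noteq> i \<longrightarrow> f j = \<one>\<^bsub>H j\<^esub>}"

definition dense_in_subspace :: "'a topology \<Rightarrow> 'a set \<Rightarrow> 'a set \<Rightarrow> bool"
  where "dense_in_subspace T Y D \<longleftrightarrow> D \<subseteq> Y \<and> (subtopology T Y) closure_of D = Y"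

text \<open>The diagonal map sends \<open>g\<close> to the family of the left cosets \<open>g G\<^bsub>S - {N}\<^esub>\<close>, \<open>N \<in> S\<close>.\<close>

definition diagonal_group ::
    "('a, 'm) monoid_scheme \<Rightarrow> 'a topology \<Rightarrow> 'a set set \<Rightarrow> ('a set \<Rightarrow> 'a set) monoid"
  where "diagonal_group G T S = product_group S (\<lambda>N. G Mod top_generated G T (S - {N}))"

definition diagonal_topology ::
    "('a, 'm) monoid_scheme \<Rightarrow> 'a topology \<Rightarrow> 'a set set \<Rightarrow> ('a set \<Rightarrow> 'a set) topology"
  where "diagonal_topology G T S =
    product_topology (\<lambda>N. quotient_group_topology G T (top_generated G T (S - {N}))) S"

definition diagonal_map ::
    "('a, 'm) monoid_scheme \<Rightarrow> 'a topology \<Rightarrow> 'a set set \<Rightarrow> 'a \<Rightarrow> 'a set \<Rightarrow> 'a set"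
  where "diagonal_map G T S g = (\<lambda>N\<in>S. g <#\<^bsub>G\<^esub> top_generated G T (S - {N}))"

definition diagonal_factor ::
    "('a, 'm) monoid_scheme \<Rightarrow> 'a topology \<Rightarrow> 'a set set \<Rightarrow> 'a set \<Rightarrow> ('a set \<Rightarrow> 'a set) set"
  where "diagonal_factor G T S N =
    product_factor S (\<lambda>N. G Mod top_generated G T (S - {N})) N"

end

theory Submission
  imports Defs "HOL-Analysis.Abstract_Topological_Spaces"
begin

text \<open>
  Write \<open>Q N\<close> for the subgroup topologically generated by \<open>S - {N}\<close>, called the cofactor of
  \<open>N\<close> below. Everything rests on one principle: a closed subgroup that contains all members
  of \<open>J\<close> contains the group topologically generated by \<open>J\<close> (\<open>top_generated_minimal\<close>).

  The kernel of the diagonal map \<open>d\<close> is the intersection of the \<open>Q N\<close>. If distinct members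
  of \<open>S\<close> commute, then \<open>Q N\<close> commutes with \<open>N\<close>, because centralizers are closed in a Hausdorff
  group. An element of all \<open>Q N\<close> therefore commutes with every \<open>N \<in> S\<close>, and so with the group
  that \<open>S\<close> generates topologically, which is \<open>G\<close>: the kernel is central. For the density,
  \<open>d\<close> maps \<open>N\<close> into the factor with index \<open>N\<close>, since \<open>N\<close> lies in \<open>Q M\<close> for every \<open>M \<noteq> N\<close>. The
  abstract group generated by \<open>S\<close> is dense in \<open>G\<close> and has the same image in \<open>G / Q N\<close> as \<open>N\<close>,
  so \<open>d N\<close> is dense in the factor.

  The quasi-direct factorizations in both parts come from one criterion,
  \<open>quasi_direct_factorizationI\<close>: it is enough to have closed subgroups \<open>C i\<close> with trivial
  intersection such that each \<open>C i\<close> contains all members of \<open>S\<close> with one possible exception.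
  Indeed, if no member of \<open>S\<close> lies in all \<open>A \<in> X\<close>, then for each \<open>i\<close> some \<open>A \<in> X\<close>
  avoids the exceptional member for \<open>i\<close>, and the group generated by \<open>A\<close> stays within \<open>C i\<close>. When \<open>d\<close> is injective,
  the \<open>Q N\<close> serve as the \<open>C i\<close>; conversely, the quasi-direct condition for
  \<open>X = {S - {N} | N \<in> S}\<close> says that the kernel of \<open>d\<close> is trivial. For a group embedded in a
  product, the \<open>C i\<close> are the kernels of the coordinate maps on the closed subgroup
  generated by the preimages of the factors, which is a topological group in its own right.
  These preimages are nontrivial because a dense subset of a nontrivial Hausdorff group is not \<open>{1}\<close>.
\<close>

section \<open>Subgroups of topological groups\<close>

lemma (in topological_group) subgroup_closure_of:
  assumes "subgroup H G"
  shows "subgroup (T closure_of H) G"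
proof (rule subgroupI)
  show "T closure_of H \<subseteq> carrier G"
    using closure_of_subset_topspace topspace_eq_carrier by metis
  have "H \<subseteq> T closure_of H"
    using assms by (simp add: closure_of_subset subgroup.subset topspace_eq_carrier)
  then show "T closure_of H \<noteq> {}"
    using subgroup.one_closed[OF assms] by blast
next
  fix a assume "a \<in> T closure_of H"
  moreover have "(\<lambda>x. inv x) ` H \<subseteq> H"
    using subgroup.m_inv_closed[OF assms] by blast
  ultimately show "inv a \<in> T closure_of H"
    using continuous_map_image_closure_subset[OF continuous_inv, of H] closure_of_mono by blast
next
  fix a b assume "a \<in> T closure_of H" "b \<in> T closure_of H"
  then have "(a, b) \<in> prod_topology T T closure_of (H \<times> H)"
    by (simp add: closure_of_Times)
  moreover have "(\<lambda>(x, y). x \<otimes> y) ` (H \<times> H) \<subseteq> H"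
    using subgroup.m_closed[OF assms] by auto
  ultimately show "a \<otimes> b \<in> T closure_of H"
    using continuous_map_image_closure_subset[OF continuous_mult, of "H \<times> H"] closure_of_mono
    by fastforce
qed

lemma (in topological_group) continuous_map_mult:
  assumes "continuous_map X T f" "continuous_map X T g"
  shows "continuous_map X T (\<lambda>x. f x \<otimes> g x)"
  using continuous_map_compose[OF continuous_map_pairedI[OF assms] continuous_mult]
  by (simp add: o_def)

lemma (in topological_group) normal_closure_of:
  assumes "H \<lhd> G"
  shows "T closure_of H \<lhd> G"
  unfolding normal_inv_iff
proof (intro conjI ballI)
  show "subgroup (T closure_of H) G"
    using assms by (simp add: normal_imp_subgroup subgroup_closure_of)
next
  fix g h assume g: "g \<in> carrier G" and h: "h \<in> T closure_of H"
  have "continuous_map T T (\<lambda>x. g \<otimes> x \<otimes> inv g)"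
    using g by (intro continuous_map_mult) (auto simp: topspace_eq_carrier)
  then have "(\<lambda>x. g \<otimes> x \<otimes> inv g) ` (T closure_of H) \<subseteq> T closure_of ((\<lambda>x. g \<otimes> x \<otimes> inv g) ` H)"
    by (rule continuous_map_image_closure_subset)
  also have "\<dots> \<subseteq> T closure_of H"
    using assms g by (intro closure_of_mono) (auto simp: normal_inv_iff)
  finally show "g \<otimes> h \<otimes> inv g \<in> T closure_of H"
    using h by blast
qed

lemma closedin_top_generated: "closedin T (top_generated G T J)"
  by (simp add: top_generated_def)

lemma (in topological_group) subgroup_top_generated:
  assumes "\<Union>J \<subseteq> carrier G"
  shows "subgroup (top_generated G T J) G"
  unfolding top_generated_def by (intro subgroup_closure_of generate_is_subgroup assms)

lemma (in topological_group) normal_top_generated: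
  assumes "\<And>N. N \<in> J \<Longrightarrow> N \<lhd> G"
  shows "top_generated G T J \<lhd> G"
  unfolding top_generated_def
proof (intro normal_closure_of normal_generateI)
  show "\<Union>J \<subseteq> carrier G"
    using assms by (auto dest!: normal_imp_subgroup subgroup.subset)
  show "g \<otimes> h \<otimes> inv g \<in> \<Union>J" if "h \<in> \<Union>J" "g \<in> carrier G" for g h
    using that assms by (auto simp: normal_inv_iff)
qed

lemma (in topological_group) subset_top_generated:
  assumes "\<Union>J \<subseteq> carrier G" "N \<in> J"
  shows "N \<subseteq> top_generated G T J"
proof -
  have "N \<subseteq> generate G (\<Union>J)"
    using assms(2) generate.incl[of _ "\<Union>J" G] by blast
  also have "\<dots> \<subseteq> top_generated G T J"
    unfolding top_generated_def
    using generate_incl[OF assms(1)] by (simp add: closure_of_subset topspace_eq_carrier)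
  finally show ?thesis .
qed

text \<open>
  The way in which properties of the members of \<open>J\<close> are passed on to the group that they
  generate: find a closed subgroup that expresses the property.
\<close>

lemma (in topological_group) top_generated_minimal:
  assumes "subgroup H G" "closedin T H" "\<Union>J \<subseteq> H"
  shows "top_generated G T J \<subseteq> H"
  unfolding top_generated_def
  using assms by (intro closure_of_minimal generate_subgroup_incl)

lemma (in topological_group) topological_group_subgroup:
  assumes "subgroup H G"
  shows "topological_group (G\<lparr>carrier := H\<rparr>) (subtopology T H)"
proof -
  interpret H: group "G\<lparr>carrier := H\<rparr>"
    by (rule subgroup.subgroup_is_group[OF assms is_group])
  show ?thesis
  proof
    show "topspace (subtopology T H) = carrier (G\<lparr>carrier := H\<rparr>)"
      using subgroup.subset[OF assms] by (auto simp: topspace_eq_carrier)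
    show "continuous_map (prod_topology (subtopology T H) (subtopology T H)) (subtopology T H)
        (\<lambda>(x, y). x \<otimes>\<^bsub>G\<lparr>carrier := H\<rparr>\<^esub> y)"
      using subgroup.m_closed[OF assms]
      by (auto simp: continuous_map_in_subtopology continuous_map_from_subtopology continuous_mult
          simp flip: subtopology_Times)
    have "continuous_map (subtopology T H) (subtopology T H) (\<lambda>x. inv x)"
      using subgroup.m_inv_closed[OF assms]
      by (auto simp: continuous_map_in_subtopology continuous_map_from_subtopology continuous_inv)
    then show "continuous_map (subtopology T H) (subtopology T H) (\<lambda>x. inv\<^bsub>G\<lparr>carrier := H\<rparr>\<^esub> x)"
      by (rule continuous_map_eq) (use assms in simp)
  qed
qed

text \<open>
  Topological generation may be computed in the whole group; in particular, the members of \<open>J\<close>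
  still generate all of \<open>top_generated G T J\<close> when it is regarded as a topological group.
\<close>

lemma (in topological_group) top_generated_subgroup:
  assumes "subgroup H G" "\<Union>J \<subseteq> H"
  shows "top_generated (G\<lparr>carrier := H\<rparr>) (subtopology T H) J = H \<inter> top_generated G T J"
proof -
  have "generate G (\<Union>J) \<subseteq> H"
    using assms by (intro generate_subgroup_incl)
  then show ?thesis
    using assms
    by (simp add: top_generated_def generate_consistent closure_of_subtopology Int_absorb1)
qed

lemma (in topological_group) closedin_kernel:
  assumes "topological_group H TH" "Hausdorff_space TH" "continuous_map T TH f"
  shows "closedin T (kernel G H f)"
proof -
  interpret H: topological_group H TH by fact
  have "closedin TH {\<one>\<^bsub>H\<^esub>}"
    using assms(2) by (simp add: closedin_Hausdorff_singleton H.topspace_eq_carrier)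
  then have "closedin T {x \<in> topspace T. f x \<in> {\<one>\<^bsub>H\<^esub>}}"
    by (rule closedin_continuous_map_preimage[OF assms(3)])
  then show ?thesis
    by (simp add: kernel_def topspace_eq_carrier)
qed

section \<open>Centralizers\<close>

lemma (in group) subgroup_centralizer:
  assumes "a \<in> carrier G"
  shows "subgroup {x \<in> carrier G. a \<otimes> x = x \<otimes> a} G"
proof (rule subgroupI)
  fix x assume x: "x \<in> {x \<in> carrier G. a \<otimes> x = x \<otimes> a}"
  then have xG: "x \<in> carrier G" and ax: "a \<otimes> x = x \<otimes> a"
    by auto
  have "inv x \<otimes> a = inv x \<otimes> (a \<otimes> x) \<otimes> inv x"
    using xG assms by (simp add: m_assoc)
  also have "\<dots> = inv x \<otimes> (x \<otimes> a) \<otimes> inv x"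
    by (simp only: ax)
  also have "\<dots> = a \<otimes> inv x"
    using xG assms by (simp add: m_assoc[symmetric])
  finally show "inv x \<in> {x \<in> carrier G. a \<otimes> x = x \<otimes> a}"
    using xG by simp
  fix y assume y: "y \<in> {x \<in> carrier G. a \<otimes> x = x \<otimes> a}"
  then have yG: "y \<in> carrier G" and ay: "a \<otimes> y = y \<otimes> a"
    by auto
  have "a \<otimes> (x \<otimes> y) = (a \<otimes> x) \<otimes> y"
    using xG yG assms by (simp only: m_assoc)
  also have "\<dots> = x \<otimes> (a \<otimes> y)"
    unfolding ax using xG yG assms by (simp only: m_assoc)
  also have "\<dots> = x \<otimes> y \<otimes> a"
    unfolding ay using xG yG assms by (simp only: m_assoc)
  finally show "x \<otimes> y \<in> {x \<in> carrier G. a \<otimes> x = x \<otimes> a}"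
    using xG yG by simp
qed (use assms in auto)

text \<open>
  In a Hausdorff group the centralizer of an element is closed, being the set where two
  continuous maps agree. Hence commutation passes from generators to topological generation.
\<close>

lemma (in topological_group) top_generated_commute:
  assumes "Hausdorff_space T" "a \<in> carrier G" "\<Union>J \<subseteq> carrier G"
    and "\<And>y. y \<in> \<Union>J \<Longrightarrow> a \<otimes> y = y \<otimes> a" and "x \<in> top_generated G T J"
  shows "a \<otimes> x = x \<otimes> a"
proof -
  have "continuous_map T T (\<lambda>x. a \<otimes> x)" "continuous_map T T (\<lambda>x. x \<otimes> a)"
    using assms(2) by (auto intro!: continuous_map_mult simp: topspace_eq_carrier)
  then have "closedin T {x \<in> topspace T. a \<otimes> x = x \<otimes> a}"
    by (rule closedin_continuous_maps_eq[OF assms(1)])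
  then have "top_generated G T J \<subseteq> {x \<in> carrier G. a \<otimes> x = x \<otimes> a}"
    using assms by (intro top_generated_minimal subgroup_centralizer) (auto simp: topspace_eq_carrier)
  then show ?thesis
    using assms(5) by blast
qed

lemma (in group) commute_if_trivial_commutator_subgroup:
  assumes "commutator_subgroup G N M = {\<one>}" "x \<in> N" "y \<in> M" "x \<in> carrier G" "y \<in> carrier G"
  shows "x \<otimes> y = y \<otimes> x"
proof -
  have "x \<otimes> y \<otimes> inv x \<otimes> inv y \<in> commutator_subgroup G N M"
    unfolding commutator_subgroup_def using assms(2,3) by (intro generate.incl) blast
  then have "x \<otimes> y \<otimes> inv x \<otimes> inv y = \<one>"
    using assms(1) by simp
  then have "x \<otimes> y \<otimes> inv x = y"
    using assms(4,5) by (simp add: inv_solve_right')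
  then show ?thesis
    using assms(4,5) by (simp add: inv_solve_right')
qed

section \<open>Recognizing quasi-direct factorizations\<close>

lemma factors_subset:
  assumes "S \<subseteq> closed_normal_subgroups G T" "J \<subseteq> S"
  shows "\<Union>J \<subseteq> carrier G"
proof (rule Union_least)
  fix N assume "N \<in> J"
  then have "N \<lhd> G"
    using assms by (auto simp: closed_normal_subgroups_def)
  then show "N \<subseteq> carrier G"
    by (rule subgroup.subset[OF normal_imp_subgroup])
qed

text \<open>
  The condition on all families \<open>X\<close> reduces to a single family of closed subgroups \<open>C i\<close> with
  trivial intersection: each \<open>C i\<close> contains the group generated by any set of factors that
  avoids the exceptional factor \<open>N i\<close>, and a family \<open>X\<close> with empty intersection has such a
  set for every \<open>i\<close>.
\<close>

lemma (in topological_group) quasi_direct_factorizationI: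
  assumes "S \<subseteq> closed_normal_subgroups G T" "{\<one>} \<notin> S" "top_generated G T S = carrier G"
    and C: "\<And>i. i \<in> I \<Longrightarrow> subgroup (C i) G" "\<And>i. i \<in> I \<Longrightarrow> closedin T (C i)"
    and N: "\<And>i. i \<in> I \<Longrightarrow> N i \<in> S" "\<And>i M. i \<in> I \<Longrightarrow> M \<in> S \<Longrightarrow> M \<noteq> N i \<Longrightarrow> M \<subseteq> C i"
    and separating: "carrier G \<inter> (\<Inter>i\<in>I. C i) \<subseteq> {\<one>}"
  shows "quasi_direct_factorization G T S"
  unfolding quasi_direct_factorization_def
proof (intro conjI allI impI assms(1-3))
  fix X assume X: "X \<subseteq> Pow S \<and> S \<inter> \<Inter>X = {}"
  have sub: "\<Union>A \<subseteq> carrier G" if "A \<in> X" for A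
    using that X factors_subset[OF assms(1)] by blast
  have "(\<Inter>A\<in>X. top_generated G T A) \<subseteq> C i" if i: "i \<in> I" for i
  proof -
    obtain A where A: "A \<in> X" "N i \<notin> A"
      using X N(1)[OF i] by blast
    have "\<Union>A \<subseteq> C i"
      using A X N(2)[OF i] by blast
    then have "top_generated G T A \<subseteq> C i"
      by (intro top_generated_minimal C i)
    then show ?thesis
      using A(1) by blast
  qed
  then have "carrier G \<inter> (\<Inter>A\<in>X. top_generated G T A) \<subseteq> carrier G \<inter> (\<Inter>i\<in>I. C i)"
    by (intro Int_mono INT_greatest subset_refl)
  also note separating
  finally have "carrier G \<inter> (\<Inter>A\<in>X. top_generated G T A) \<subseteq> {\<one>}" .
  moreover have "\<one> \<in> top_generated G T A" if "A \<in> X" for A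
    using subgroup.one_closed[OF subgroup_top_generated[OF sub[OF that]]] .
  ultimately show "carrier G \<inter> (\<Inter>A\<in>X. top_generated G T A) = {\<one>}"
    by blast
qed

section \<open>The diagonal map of a generalized central factorization\<close>

lemma hom_into_product_group:
  assumes "group G" "\<And>i. i \<in> I \<Longrightarrow> (\<lambda>x. f x i) \<in> hom G (H i)"
    "\<And>x. x \<in> carrier G \<Longrightarrow> f x \<in> extensional I"
  shows "f \<in> hom G (product_group I H)"
proof (rule homI)
  show "f x \<in> carrier (product_group I H)" if "x \<in> carrier G" for x
    using assms(2,3) that by (auto simp: PiE_iff hom_def Pi_iff)
  show "f (x \<otimes>\<^bsub>G\<^esub> y) = f x \<otimes>\<^bsub>product_group I H\<^esub> f y" if xy: "x \<in> carrier G" "y \<in> carrier G" for x y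
  proof (rule extensionalityI)
    have "x \<otimes>\<^bsub>G\<^esub> y \<in> carrier G"
      using assms(1) xy by (simp add: group.is_monoid monoid.m_closed)
    then show "f (x \<otimes>\<^bsub>G\<^esub> y) \<in> extensional I"
      by (rule assms(3))
  qed (use assms(2) xy in \<open>auto simp: hom_def\<close>)
qed

context topological_group
begin

context
  fixes S
  assumes S: "S \<subseteq> closed_normal_subgroups G T"
begin

lemma normal_cofactor: "top_generated G T (S - {N}) \<lhd> G"
  using S by (intro normal_top_generated) (auto simp: closed_normal_subgroups_def)

lemma subgroup_cofactor: "subgroup (top_generated G T (S - {N})) G"
  using normal_cofactor by (rule normal_imp_subgroup)

text \<open>
  The diagonal map is given by left cosets, the quotient group by right cosets; they
  agree because the cofactors are normal.
\<close>

lemma diagonal_map_eq: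
  assumes "g \<in> carrier G"
  shows "diagonal_map G T S g = (\<lambda>N\<in>S. top_generated G T (S - {N}) #> g)"
  unfolding diagonal_map_def
  using assms normal.coset_eq[OF normal_cofactor] by (auto intro!: restrict_ext)

lemma group_diagonal_group: "group (diagonal_group G T S)"
  unfolding diagonal_group_def by (simp add: normal.factorgroup_is_group[OF normal_cofactor])

lemma diagonal_map_hom: "diagonal_map G T S \<in> hom G (diagonal_group G T S)"
proof -
  have "(\<lambda>g. \<lambda>N\<in>S. top_generated G T (S - {N}) #> g) \<in> hom G (diagonal_group G T S)"
    unfolding diagonal_group_def
    by (intro hom_into_product_group)
      (auto intro: normal.r_coset_hom_Mod[OF normal_cofactor])
  then show ?thesis
    by (auto simp: hom_def Pi_iff diagonal_map_eq)
qed

lemma continuous_diagonal_map: "continuous_map T (diagonal_topology G T S) (diagonal_map G T S)"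
proof -
  have "continuous_map T (diagonal_topology G T S) (\<lambda>g. \<lambda>N\<in>S. top_generated G T (S - {N}) #> g)"
    unfolding diagonal_topology_def continuous_map_componentwise
    by (auto intro!: quotient_imp_continuous_map quotient_map_quotient_group_topology)
  then show ?thesis
    by (rule continuous_map_eq) (simp add: diagonal_map_eq topspace_eq_carrier)
qed

lemma r_coset_cofactor_eq_iff:
  assumes "g \<in> carrier G"
  shows "top_generated G T (S - {N}) #> g = top_generated G T (S - {N}) \<longleftrightarrow>
    g \<in> top_generated G T (S - {N})"
  using coset_join1[OF _ assms subgroup_cofactor] coset_join2[OF assms subgroup_cofactor] by auto

lemma kernel_diagonal_map:
  "kernel G (diagonal_group G T S) (diagonal_map G T S) =
    carrier G \<inter> (\<Inter>N\<in>S. top_generated G T (S - {N}))"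
proof -
  have "diagonal_map G T S g = \<one>\<^bsub>diagonal_group G T S\<^esub> \<longleftrightarrow>
      (\<forall>N\<in>S. g \<in> top_generated G T (S - {N}))" if "g \<in> carrier G" for g
    using that by (auto simp: diagonal_map_eq diagonal_group_def restrict_def fun_eq_iff
        r_coset_cofactor_eq_iff)
  then show ?thesis
    by (auto simp: kernel_def)
qed

lemma subset_cofactor: "M \<in> S \<Longrightarrow> M \<noteq> N \<Longrightarrow> M \<subseteq> top_generated G T (S - {N})"
  by (rule subset_top_generated[OF factors_subset[OF S]]) auto

text \<open>
  The diagonal map sends \<open>N\<close> into the factor with index \<open>N\<close>, because \<open>N\<close> lies in all the other
  cofactors.
\<close>

lemma diagonal_map_factor:
  assumes "N \<in> S" "n \<in> N"
  shows "diagonal_map G T S n =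
    (\<lambda>M\<in>S. if M = N then top_generated G T (S - {N}) #> n else top_generated G T (S - {M}))"
proof -
  have "n \<in> carrier G"
    using assms factors_subset[OF S, of S] by blast
  moreover have "n \<in> top_generated G T (S - {M})" if "M \<noteq> N" for M
    using assms subset_cofactor[of N M] that by blast
  ultimately show ?thesis
    unfolding diagonal_map_eq[OF \<open>n \<in> carrier G\<close>]
    by (intro restrict_ext) (simp add: r_coset_cofactor_eq_iff)
qed

text \<open>
  Modulo the cofactor of \<open>N\<close>, all members of \<open>S\<close> other than \<open>N\<close> become trivial, so nothing
  but the image of \<open>N\<close> remains of the abstract group generated by \<open>S\<close>.
\<close>

lemma r_coset_cofactor_in_factor:
  assumes N: "N \<in> S" and x: "x \<in> generate G (\<Union>S)"
  shows "\<exists>n\<in>N. top_generated G T (S - {N}) #> x = top_generated G T (S - {N}) #> n"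
proof -
  let ?Q = "top_generated G T (S - {N})"
  interpret group_hom G "G Mod ?Q" "\<lambda>g. ?Q #> g"
    using normal.factorgroup_is_group[OF normal_cofactor] normal.r_coset_hom_Mod[OF normal_cofactor]
    by (simp add: group_hom_def group_hom_axioms_def)
  have sgN: "subgroup N G"
    using N S by (auto simp: closed_normal_subgroups_def normal_imp_subgroup)
  have "(\<lambda>g. ?Q #> g) ` \<Union>S \<subseteq> (\<lambda>g. ?Q #> g) ` N"
  proof clarify
    fix y M assume y: "M \<in> S" "y \<in> M"
    show "?Q #> y \<in> (\<lambda>g. ?Q #> g) ` N"
    proof (cases "M = N")
      case False
      have "y \<in> carrier G"
        using y factors_subset[OF S, of S] by blast
      moreover have "y \<in> ?Q"
        using y False subset_cofactor by blast
      ultimately have "?Q #> y = ?Q #> \<one>"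
        using r_coset_cofactor_eq_iff[of y N] r_coset_cofactor_eq_iff[of \<one> N]
          subgroup.one_closed[OF subgroup_cofactor[of N]] by simp
      then show ?thesis
        using subgroup.one_closed[OF sgN] by (rule image_eqI)
    qed (use y in blast)
  qed
  then have "generate (G Mod ?Q) ((\<lambda>g. ?Q #> g) ` \<Union>S) \<subseteq> (\<lambda>g. ?Q #> g) ` N"
    by (intro H.generate_subgroup_incl subgroup_img_is_subgroup sgN)
  then have "?Q #> x \<in> (\<lambda>g. ?Q #> g) ` N"
    using x by (simp add: generate_img[OF factors_subset[OF S subset_refl]] image_subset_iff)
  then show ?thesis
    by blast
qed

text \<open>
  The factor with index \<open>N\<close> is the continuous image of \<open>G\<close> under the map \<open>\<phi>\<close> that projects to the
  coordinate \<open>N\<close> and is trivial elsewhere. Continuity carries the density in \<open>G\<close> of the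
  abstract group generated by \<open>S\<close> over to its image, which the diagonal map already attains
  on \<open>N\<close>.
\<close>

lemma dense_diagonal_image_in_factor:
  assumes gen: "top_generated G T S = carrier G" and N: "N \<in> S"
  shows "dense_in_subspace (diagonal_topology G T S) (diagonal_factor G T S N)
    (diagonal_map G T S ` carrier G \<inter> diagonal_factor G T S N)"
proof -
  let ?Q = "\<lambda>M. top_generated G T (S - {M})"
  let ?F = "diagonal_factor G T S N"
  define \<phi> where "\<phi> g = (\<lambda>M\<in>S. if M = N then ?Q N #> g else ?Q M)" for g
  have Q_in: "?Q M \<in> carrier (G Mod ?Q M)" for M
    using monoid.one_closed[OF group.is_monoid[OF normal.factorgroup_is_group[OF normal_cofactor]]]
    by simp
  have F: "?F = \<phi> ` carrier G"
  proof
    show "\<phi> ` carrier G \<subseteq> ?F"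
    proof clarify
      fix g assume g: "g \<in> carrier G"
      show "\<phi> g \<in> ?F"
        using g Q_in by (auto simp: diagonal_factor_def product_factor_def \<phi>_def carrier_FactGroup)
    qed
    show "?F \<subseteq> \<phi> ` carrier G"
    proof
      fix f assume f: "f \<in> ?F"
      then obtain g where g: "g \<in> carrier G" "f N = ?Q N #> g"
        using N by (auto simp: diagonal_factor_def product_factor_def carrier_FactGroup PiE_iff)
      have "f = \<phi> g"
      proof (rule extensionalityI)
        show "f \<in> extensional S"
          using f by (auto simp: diagonal_factor_def product_factor_def PiE_iff)
      qed (use f g in \<open>auto simp: diagonal_factor_def product_factor_def \<phi>_def\<close>)
      then show "f \<in> \<phi> ` carrier G"
        using g by blast
    qed
  qed
  have "continuous_map T (quotient_group_topology G T (?Q M))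
      (\<lambda>g. if M = N then ?Q N #> g else ?Q M)" for M
  proof (cases "M = N")
    case True
    then show ?thesis
      by (simp add: quotient_imp_continuous_map quotient_map_quotient_group_topology)
  next
    case False
    then show ?thesis
      using Q_in by (simp add: topspace_quotient_group_topology)
  qed
  then have cont: "continuous_map T (diagonal_topology G T S) \<phi>"
    unfolding diagonal_topology_def continuous_map_componentwise \<phi>_def by auto
  have "\<phi> ` generate G (\<Union>S) \<subseteq> diagonal_map G T S ` N"
  proof clarify
    fix x assume "x \<in> generate G (\<Union>S)"
    then obtain n where n: "n \<in> N" "?Q N #> x = ?Q N #> n"
      using r_coset_cofactor_in_factor[OF N] by blast
    have "\<phi> x = diagonal_map G T S n"
      unfolding diagonal_map_factor[OF N n(1)] \<phi>_def n(2) ..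
    then show "\<phi> x \<in> diagonal_map G T S ` N"
      using n by blast
  qed
  also have "\<dots> \<subseteq> diagonal_map G T S ` carrier G \<inter> ?F" (is "_ \<subseteq> ?D")
  proof -
    have "N \<subseteq> carrier G"
      using factors_subset[OF S, of S] N by blast
    moreover have "diagonal_map G T S n = \<phi> n" if "n \<in> N" for n
      unfolding diagonal_map_factor[OF N that] \<phi>_def ..
    ultimately show ?thesis
      by (force simp: F)
  qed
  finally have "diagonal_topology G T S closure_of (\<phi> ` generate G (\<Union>S)) \<subseteq>
      diagonal_topology G T S closure_of ?D"
    by (rule closure_of_mono)
  then have "?F \<subseteq> diagonal_topology G T S closure_of ?D"
    using continuous_map_image_closure_subset[OF cont, of "generate G (\<Union>S)"] gen
    by (auto simp: F top_generated_def)
  then show ?thesis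
    by (auto simp: dense_in_subspace_def closure_of_subtopology Int_absorb1)
qed

end

text \<open>
  An element \<open>x\<close> of the kernel lies in the cofactor of every \<open>N \<in> S\<close>, which is generated by
  subgroups commuting with \<open>N\<close>. So \<open>x\<close> commutes with every \<open>N \<in> S\<close>, and therefore with all
  of \<open>G\<close>.
\<close>

lemma kernel_diagonal_map_central:
  assumes "Hausdorff_space T" and S: "generalized_central_factorization G T S"
  shows "kernel G (diagonal_group G T S) (diagonal_map G T S) \<subseteq> group_center G"
proof
  fix x assume x: "x \<in> kernel G (diagonal_group G T S) (diagonal_map G T S)"
  have cl: "S \<subseteq> closed_normal_subgroups G T" and gen: "top_generated G T S = carrier G"
    and comm: "\<And>N M. N \<in> S \<Longrightarrow> M \<in> S \<Longrightarrow> N \<noteq> M \<Longrightarrow> commutator_subgroup G N M = {\<one>}"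
    using S by (auto simp: generalized_central_factorization_def)
  note sub = factors_subset[OF cl]
  have xG: "x \<in> carrier G" and xQ: "\<And>N. N \<in> S \<Longrightarrow> x \<in> top_generated G T (S - {N})"
    using x by (auto simp: kernel_diagonal_map[OF cl])
  have "x \<otimes> n = n \<otimes> x" if n: "N \<in> S" "n \<in> N" for n N
  proof -
    have nG: "n \<in> carrier G"
      using n sub[of S] by blast
    have "n \<otimes> x = x \<otimes> n"
    proof (rule top_generated_commute[OF assms(1) nG sub[of "S - {N}"] _ xQ[OF n(1)]])
      fix y assume "y \<in> \<Union>(S - {N})"
      then obtain M where M: "M \<in> S" "N \<noteq> M" "y \<in> M"
        by blast
      then show "n \<otimes> y = y \<otimes> n"
        using commute_if_trivial_commutator_subgroup[OF comm[OF n(1) M(1,2)] n(2) M(3) nG] sub[of S]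
        by blast
    qed blast
    then show ?thesis
      by simp
  qed
  then have "x \<otimes> y = y \<otimes> x" if "y \<in> \<Union>S" for y
    using that by blast
  from top_generated_commute[OF assms(1) xG sub[OF subset_refl] this]
  have "x \<otimes> g = g \<otimes> x" if "g \<in> carrier G" for g
    using that gen by simp
  then show "x \<in> group_center G"
    using xG by (simp add: group_center_def)
qed

text \<open>
  Both conditions say that the cofactors intersect trivially. For quasi-direct
  factorizations this is the case \<open>X = {S - {N} | N \<in> S}\<close>, to which the criterion above reduces
  all others.
\<close>

lemma quasi_direct_iff_inj_diagonal_map:
  assumes S: "generalized_central_factorization G T S"
  shows "quasi_direct_factorization G T S \<longleftrightarrow> inj_on (diagonal_map G T S) (carrier G)"
proof -
  have cl: "S \<subseteq> closed_normal_subgroups G T"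
    using S by (simp add: generalized_central_factorization_def)
  let ?Q = "\<lambda>N. top_generated G T (S - {N})"
  interpret d: group_hom G "diagonal_group G T S" "diagonal_map G T S"
    using group_diagonal_group[OF cl] diagonal_map_hom[OF cl]
    by (simp add: group_hom_def group_hom_axioms_def)
  have "quasi_direct_factorization G T S \<longleftrightarrow> carrier G \<inter> (\<Inter>N\<in>S. ?Q N) = {\<one>}"
  proof
    assume "quasi_direct_factorization G T S"
    then have "\<And>X. X \<subseteq> Pow S \<Longrightarrow> S \<inter> \<Inter>X = {} \<Longrightarrow>
        carrier G \<inter> (\<Inter>A\<in>X. top_generated G T A) = {\<one>}"
      by (simp add: quasi_direct_factorization_def)
    from this[of "(\<lambda>N. S - {N}) ` S"]
    have "carrier G \<inter> (\<Inter>A\<in>(\<lambda>N. S - {N}) ` S. top_generated G T A) = {\<one>}"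
      by blast
    then show "carrier G \<inter> (\<Inter>N\<in>S. ?Q N) = {\<one>}"
      by (simp add: image_image)
  next
    assume "carrier G \<inter> (\<Inter>N\<in>S. ?Q N) = {\<one>}"
    then show "quasi_direct_factorization G T S"
      using S subgroup_cofactor[OF cl] subset_cofactor[OF cl]
      by (intro quasi_direct_factorizationI[where I = S and C = ?Q and N = "\<lambda>N. N"])
        (auto simp: generalized_central_factorization_def closedin_top_generated)
  qed
  then show ?thesis
    by (simp add: d.inj_iff_trivial_ker kernel_diagonal_map[OF cl])
qed

end

section \<open>Groups embedded in a product\<close>

text \<open>Points are closed in a Hausdorff space, so a single point is dense only in itself.\<close>

lemma dense_in_subspace_nontrivial:
  assumes "Hausdorff_space X" "dense_in_subspace X Y D" "Y \<subseteq> topspace X" "a \<in> Y" "Y \<noteq> {a}"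
  shows "D \<noteq> {a}"
proof
  assume "D = {a}"
  moreover have "closedin (subtopology X Y) {a}"
    using assms by (intro closedin_Hausdorff_singleton Hausdorff_space_subtopology) auto
  ultimately show False
    using assms(2,5) by (simp add: dense_in_subspace_def closure_of_closedin)
qed

text \<open>
  Here \<open>F i\<close> is the preimage of the factor with index \<open>i\<close> under the coordinate maps \<open>p\<close>. The
  kernels of the coordinate maps separate points, and the kernel of the coordinate \<open>i\<close>
  contains every \<open>F j\<close> with \<open>j \<noteq> i\<close>; moreover \<open>F i\<close> is closed and normal as an intersection of
  such kernels.
\<close>

lemma (in topological_group) quasi_direct_factorization_if_coordinates_separate:
  fixes H :: "'i \<Rightarrow> ('b, 'n) monoid_scheme" and p :: "'a \<Rightarrow> 'i \<Rightarrow> 'b"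
  assumes H: "\<And>i. i \<in> I \<Longrightarrow> topological_group (H i) (TH i)" "\<And>i. i \<in> I \<Longrightarrow> Hausdorff_space (TH i)"
    and p: "\<And>i. i \<in> I \<Longrightarrow> (\<lambda>g. p g i) \<in> hom G (H i)"
      "\<And>i. i \<in> I \<Longrightarrow> continuous_map T (TH i) (\<lambda>g. p g i)"
    and separating: "\<And>g. g \<in> carrier G \<Longrightarrow> (\<And>i. i \<in> I \<Longrightarrow> p g i = \<one>\<^bsub>H i\<^esub>) \<Longrightarrow> g = \<one>"
    and F: "\<And>i. i \<in> I \<Longrightarrow> F i = {g \<in> carrier G. \<forall>j\<in>I. j \<noteq> i \<longrightarrow> p g j = \<one>\<^bsub>H j\<^esub>}"
    and "\<And>i. i \<in> I \<Longrightarrow> F i \<noteq> {\<one>}" and "top_generated G T (F ` I) = carrier G"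
  shows "quasi_direct_factorization G T (F ` I)"
proof -
  let ?C = "\<lambda>i. kernel G (H i) (\<lambda>g. p g i)"
  have hom: "group_hom G (H i) (\<lambda>g. p g i)" if "i \<in> I" for i
    using p(1) H(1) that
    by (auto simp: group_hom_def group_hom_axioms_def topological_group_def)
  have closed: "closedin T (?C i)" if "i \<in> I" for i
    using that by (intro closedin_kernel[where TH = "TH i"] H p)
  have normal: "?C i \<lhd> G" if "i \<in> I" for i
    using group_hom.normal_kernel[OF hom[OF that]] .
  have F_eq: "F i = \<Inter>(insert (carrier G) (?C ` (I - {i})))" if "i \<in> I" for i
    using F[OF that] by (auto simp: kernel_def)
  have "closedin T (F i)" if "i \<in> I" for i
    \<comment> \<open>Keeping \<open>carrier G\<close> in the intersection covers the case of a single coordinate.\<close>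
    unfolding F_eq[OF that] using closed
    by (intro closedin_Inter) (auto simp flip: topspace_eq_carrier)
  moreover have "F i \<lhd> G" if "i \<in> I" for i
  proof -
    have "\<And>N. N \<in> insert (carrier G) (?C ` (I - {i})) \<Longrightarrow> N \<lhd> G"
      using normal normal_self by auto
    then show ?thesis
      unfolding F_eq[OF that] normal_inv_iff by (intro conjI subgroups_Inter) auto
  qed
  ultimately have "F ` I \<subseteq> closed_normal_subgroups G T"
    by (auto simp: closed_normal_subgroups_def)
  moreover have "{\<one>} \<notin> F ` I"
    using assms(7) by auto
  moreover have "M \<subseteq> ?C i" if "i \<in> I" "M \<in> F ` I" "M \<noteq> F i" for i M
    using that by (auto simp: F kernel_def)
  moreover have "carrier G \<inter> (\<Inter>i\<in>I. ?C i) \<subseteq> {\<one>}"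
    using separating by (auto simp: kernel_def)
  ultimately show ?thesis
    using assms(8) closed normal
    by (intro quasi_direct_factorizationI[where I = I and C = ?C and N = F])
      (auto simp: normal_imp_subgroup)
qed

theorem theorem1p7:
  fixes G :: "('a, 'm) monoid_scheme" and T :: "'a topology"
  assumes "topological_group G T" and "Hausdorff_space T"
  shows
    "(\<forall>S. generalized_central_factorization G T S \<and> nontrivial_factorization S \<longrightarrow>
        diagonal_map G T S \<in> hom G (diagonal_group G T S) \<and>
        continuous_map T (diagonal_topology G T S) (diagonal_map G T S) \<and>
        (\<forall>N\<in>S. dense_in_subspace (diagonal_topology G T S) (diagonal_factor G T S N)
                  (diagonal_map G T S ` carrier G \<inter> diagonal_factor G T S N)) \<and>
        kernel G (diagonal_group G T S) (diagonal_map G T S) \<subseteq> group_center G \<and>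
        (quasi_direct_factorization G T S \<longleftrightarrow> inj_on (diagonal_map G T S) (carrier G)))
     \<and>
     (\<forall>(\<K> :: ('b monoid \<times> 'b topology) set) \<delta> S L.
        (\<forall>(K, TK)\<in>\<K>. topological_group K TK \<and> Hausdorff_space TK \<and> carrier K \<noteq> {\<one>\<^bsub>K\<^esub>}) \<and>
        \<delta> \<in> hom G (product_group \<K> fst) \<and>
        continuous_map T (product_topology snd \<K>) \<delta> \<and>
        inj_on \<delta> (carrier G) \<and>
        (\<forall>K\<in>\<K>. dense_in_subspace (product_topology snd \<K>) (product_factor \<K> fst K)
                  (\<delta> ` carrier G \<inter> product_factor \<K> fst K)) \<and>
        S = {{g \<in> carrier G. \<delta> g \<in> product_factor \<K> fst K} | K. K \<in> \<K>} \<and>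
        L = top_generated G T S
        \<longrightarrow> subgroup L G \<and> closedin T L \<and>
            quasi_direct_factorization (G\<lparr>carrier := L\<rparr>) (subtopology T L) S)"
proof (intro conjI allI impI ballI; (elim conjE)?)
  interpret topological_group G T by fact
  fix S assume S: "generalized_central_factorization G T S"
  then have cl: "S \<subseteq> closed_normal_subgroups G T" "top_generated G T S = carrier G"
    by (auto simp: generalized_central_factorization_def)
  show "diagonal_map G T S \<in> hom G (diagonal_group G T S)"
    by (rule diagonal_map_hom[OF cl(1)])
  show "continuous_map T (diagonal_topology G T S) (diagonal_map G T S)"
    by (rule continuous_diagonal_map[OF cl(1)])
  show "kernel G (diagonal_group G T S) (diagonal_map G T S) \<subseteq> group_center G"
    by (rule kernel_diagonal_map_central[OF assms(2) S])
  show "quasi_direct_factorization G T S \<longleftrightarrow> inj_on (diagonal_map G T S) (carrier G)"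
    by (rule quasi_direct_iff_inj_diagonal_map[OF S])
  show "dense_in_subspace (diagonal_topology G T S) (diagonal_factor G T S N)
          (diagonal_map G T S ` carrier G \<inter> diagonal_factor G T S N)" if "N \<in> S" for N
    by (rule dense_diagonal_image_in_factor[OF cl that])
next
  interpret topological_group G T by fact
  fix \<K> :: "('b monoid \<times> 'b topology) set" and \<delta> S L
  assume K: "\<forall>(K, TK)\<in>\<K>. topological_group K TK \<and> Hausdorff_space TK \<and> carrier K \<noteq> {\<one>\<^bsub>K\<^esub>}"
    and hom: "\<delta> \<in> hom G (product_group \<K> fst)"
    and cont: "continuous_map T (product_topology snd \<K>) \<delta>"
    and inj: "inj_on \<delta> (carrier G)"
    and dense: "\<forall>K\<in>\<K>. dense_in_subspace (product_topology snd \<K>) (product_factor \<K> fst K)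
                  (\<delta> ` carrier G \<inter> product_factor \<K> fst K)"
    and S: "S = {{g \<in> carrier G. \<delta> g \<in> product_factor \<K> fst K} | K. K \<in> \<K>}"
    and L: "L = top_generated G T S"
  have tg: "topological_group (fst K) (snd K)" "Hausdorff_space (snd K)" "carrier (fst K) \<noteq> {\<one>\<^bsub>fst K\<^esub>}"
    if "K \<in> \<K>" for K
    using K that by auto
  have grp: "group (fst K)" if "K \<in> \<K>" for K
    using tg(1)[OF that] by (rule topological_group.axioms)
  interpret \<delta>: group_hom G "product_group \<K> fst" \<delta>
    using hom grp by (simp add: group_hom_def group_hom_axioms_def)
  define F where "F K = {g \<in> carrier G. \<delta> g \<in> product_factor \<K> fst K}" for K
  have SF: "S = F ` \<K>"
    by (auto simp: S F_def)
  have sub: "\<Union>S \<subseteq> carrier G"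
    by (auto simp: S)
  show sg: "subgroup L G"
    unfolding L by (rule subgroup_top_generated[OF sub])
  show "closedin T L"
    unfolding L by (rule closedin_top_generated)
  have FL: "F K \<subseteq> L" if "K \<in> \<K>" for K
    unfolding L using that by (intro subset_top_generated[OF sub]) (simp add: SF)
  interpret L: topological_group "G\<lparr>carrier := L\<rparr>" "subtopology T L"
    by (rule topological_group_subgroup[OF sg])
  have LG: "L \<subseteq> carrier G"
    using sg by (rule subgroup.subset)
  have \<delta>: "\<delta> g \<in> (\<Pi>\<^sub>E K\<in>\<K>. carrier (fst K))" if "g \<in> carrier G" for g
    using \<delta>.hom_closed[OF that] by simp
  have "F K \<noteq> {\<one>\<^bsub>G\<^esub>}" if KK: "K \<in> \<K>" for K
  proof
    assume F1: "F K = {\<one>\<^bsub>G\<^esub>}"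
    let ?P = "product_factor \<K> fst K"
    have one: "\<one>\<^bsub>product_group \<K> fst\<^esub> \<in> ?P"
      using grp by (auto simp: product_factor_def group.is_monoid)
    have "\<delta> ` carrier G \<inter> ?P = \<delta> ` F K"
      by (auto simp: F_def)
    then have "\<delta> ` carrier G \<inter> ?P = {\<one>\<^bsub>product_group \<K> fst\<^esub>}"
      using F1 \<delta>.hom_one by simp
    moreover have "\<delta> ` carrier G \<inter> ?P \<noteq> {\<one>\<^bsub>product_group \<K> fst\<^esub>}"
    proof (rule dense_in_subspace_nontrivial[OF _ dense[rule_format, OF KK] _ one])
      show "Hausdorff_space (product_topology snd \<K>)"
        using tg(2) by (auto simp: Hausdorff_space_product_topology)
      show "?P \<subseteq> topspace (product_topology snd \<K>)"
        using topological_group.topspace_eq_carrier[OF tg(1)]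
        by (auto simp: product_factor_def PiE_iff extensional_def)
      obtain k where k: "k \<in> carrier (fst K)" "k \<noteq> \<one>\<^bsub>fst K\<^esub>"
        using tg(3)[OF KK] monoid.one_closed[OF group.is_monoid[OF grp[OF KK]]] by blast
      have "(\<lambda>J\<in>\<K>. if J = K then k else \<one>\<^bsub>fst J\<^esub>) \<in> ?P"
        using k grp by (auto simp: product_factor_def group.is_monoid)
      moreover have "(\<lambda>J\<in>\<K>. if J = K then k else \<one>\<^bsub>fst J\<^esub>) \<noteq> \<one>\<^bsub>product_group \<K> fst\<^esub>"
      proof
        assume "(\<lambda>J\<in>\<K>. if J = K then k else \<one>\<^bsub>fst J\<^esub>) = \<one>\<^bsub>product_group \<K> fst\<^esub>"
        from fun_cong[OF this, of K] show False
          using k KK by simp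
      qed
      ultimately show "?P \<noteq> {\<one>\<^bsub>product_group \<K> fst\<^esub>}"
        by blast
    qed
    ultimately show False
      by blast
  qed
  moreover have "(\<lambda>g. \<delta> g K) \<in> hom (G\<lparr>carrier := L\<rparr>) (fst K)" if "K \<in> \<K>" for K
    using that LG \<delta> \<delta>.hom_mult by (auto simp: hom_def PiE_iff subset_iff)
  moreover have "continuous_map (subtopology T L) (snd K) (\<lambda>g. \<delta> g K)" if "K \<in> \<K>" for K
    using that cont
    by (intro continuous_map_from_subtopology) (auto simp: continuous_map_componentwise)
  moreover have "g = \<one>\<^bsub>G\<^esub>" if "g \<in> L" and 1: "\<And>K. K \<in> \<K> \<Longrightarrow> \<delta> g K = \<one>\<^bsub>fst K\<^esub>" for g
  proof -
    have g: "g \<in> carrier G"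
      using that(1) LG by blast
    have "\<delta> g = \<one>\<^bsub>product_group \<K> fst\<^esub>"
      using \<delta>[OF g] 1 by (auto simp: fun_eq_iff PiE_iff extensional_def)
    then show ?thesis
      using inj g \<delta>.inj_on_one_iff by blast
  qed
  moreover have "F K = {g \<in> L. \<forall>J\<in>\<K>. J \<noteq> K \<longrightarrow> \<delta> g J = \<one>\<^bsub>fst J\<^esub>}" if "K \<in> \<K>" for K
  proof -
    have "F K = {g \<in> carrier G. \<forall>J\<in>\<K>. J \<noteq> K \<longrightarrow> \<delta> g J = \<one>\<^bsub>fst J\<^esub>}"
      unfolding F_def product_factor_def using \<delta> by (intro Collect_cong) (simp cong: conj_cong)
    then show ?thesis
      using FL[OF that] LG by blast
  qed
  moreover have "top_generated (G\<lparr>carrier := L\<rparr>) (subtopology T L) (F ` \<K>) = L"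
  proof -
    have "\<Union>(F ` \<K>) \<subseteq> L"
      using FL by blast
    then have "top_generated (G\<lparr>carrier := L\<rparr>) (subtopology T L) (F ` \<K>) = L \<inter> L"
      using top_generated_subgroup[OF sg] L SF by simp
    then show ?thesis
      by simp
  qed
  ultimately show "quasi_direct_factorization (G\<lparr>carrier := L\<rparr>) (subtopology T L) S"
    unfolding SF using tg
    by (intro L.quasi_direct_factorization_if_coordinates_separate[where H = fst and TH = snd and p = \<delta>])
      auto
qed

end
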